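(* Let $m\ge 1$. The quadrature rule $G^*_{m+1}(f)=\sum_{k=1}^{m+1}\lambda_k^* f(x_k^* )$ associated with the measure $d\mu$ has degree of exactness at least $2m-1$ (i.e. $G^*_{m+1}(p)=\int_{\mathcal D}p\,d\mu$ for all polynomials $p$ of degree at most $2m-1$), its nodes $x_k^*$ interlace with the Gauss nodes (the zeros of $p_m$), and its weights are given, for $k=1,\dots,m+1$, by $$\lambda_k^*=\frac{\beta_m+\beta_{m+1}}{\beta_m}\,\frac{\|p_m\|_\mu^2}{q_{2m+1}'(x_k^* )}>0,$$ where $q_{2m+1}(x)=p_m(x)\,p^*_{m+1}(x)$ and $p^*_{m+1}(x)=\prod_{k=1}^{m+1}(x-x_k^* )$.
   Context: $\mathcal D\subseteq\mathbb R$ is a bounded or infinite interval and $d\mu$ is a nonnegative measure supported on $\mathcal D$ with infinitely many points of support and finite moments. Put $\langle f,g\rangle_\mu=\int_{\mathcal D}f g\,d\mu$ and $\|f\|_\mu=\langle f,f\rangle_\mu^{1/2}$. The monic orthogonal polynomials $p_k$ ($\deg p_k=k$, $\langle x^j,p_k\rangle_\mu=0$ for $0\le j\le k-1$) satisfy $p_{-1}=0$, $p_0=1$, $p_{k+1}(x)=(x-\alpha_k)p_k(x)-\beta_kp_{k-1}(x)$, with $\alpha_k=\langle xp_k,p_k\rangle_\mu/\langle p_k,p_k\rangle_\mu$ for $k\ge0$, $\beta_k=\langle p_k,p_k\rangle_\mu/\langle p_{k-1},p_{k-1}\rangle_\mu$ for $k\ge1$, and $\beta_0=\langle p_0,p_0\rangle_\mu$.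 $J_m$ is the symmetric tridiagonal $m\times m$ matrix with diagonal $\alpha_0,\dots,\alpha_{m-1}$ and sub-/superdiagonal $\sqrt{\beta_1},\dots,\sqrt{\beta_{m-1}}$. The $m$-point Gauss rule $G_m$ has as nodes the zeros of $p_m$ (the eigenvalues of $J_m$). Define the symmetric tridiagonal $(m+1)\times(m+1)$ matrix $$J^*_{m+1}=\begin{bmatrix}J_m&\sqrt{\beta_m+\beta_{m+1}}\,\mathbf e_m\\ \sqrt{\beta_m+\beta_{m+1}}\,\mathbf e_m^T&\alpha_m\end{bmatrix},$$ where $\mathbf e_m\in\mathbb R^m$ is the last axis vector. The nodes $x_1^*<\dots<x_{m+1}^*$ of $G^*_{m+1}$ are the eigenvalues of $J^*_{m+1}$, and the weights are $\lambda_k^*=\beta_0 (v^*_{k,1})^2$, where $v^*_{k,1}$ is the first component of a normalized real eigenvector of $J^*_{m+1}$ for the eigenvalue $x_k^*$. *)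

theory Defs
  imports "HOL-Analysis.Analysis" "Jordan_Normal_Form.Char_Poly"
begin

definition support_points :: "real measure \<Rightarrow> real set" where
  "support_points M = {x. \<forall>e>0. emeasure M (ball x e) > 0}"

text \<open>``Supported on D'' means that the complement of \<open>D\<close> is a null set. The topological support may
  therefore contain an endpoint of \<open>D\<close> that does not belong to \<open>D\<close>.\<close>

definition admissible_measure :: "real set \<Rightarrow> real measure \<Rightarrow> bool" where
  "admissible_measure D M \<longleftrightarrow>
     is_interval D \<and> sets M = sets borel \<and> emeasure M (- D) = 0 \<and>
     infinite (support_points M) \<and>
     (\<forall>k::nat. set_integrable M D (\<lambda>x. x ^ k))"

definition inner_mu :: "real set \<Rightarrow> real measure \<Rightarrow> (real \<Rightarrow> real) \<Rightarrow> (real \<Rightarrow> real) \<Rightarrow> real" where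
  "inner_mu D M f g = (LINT x:D|M. f x * g x)"

definition norm_mu :: "real set \<Rightarrow> real measure \<Rightarrow> (real \<Rightarrow> real) \<Rightarrow> real" where
  "norm_mu D M f = sqrt (inner_mu D M f f)"

text \<open>For an admissible measure there is exactly one such polynomial for every \<open>k\<close>.\<close>

definition orthopoly :: "real set \<Rightarrow> real measure \<Rightarrow> nat \<Rightarrow> real poly" where
  "orthopoly D M k = (THE p. degree p = k \<and> lead_coeff p = 1 \<and>
     (\<forall>j<k. inner_mu D M (\<lambda>x. x ^ j) (poly p) = 0))"

definition rec_alpha :: "real set \<Rightarrow> real measure \<Rightarrow> nat \<Rightarrow> real" where
  "rec_alpha D M k =
     inner_mu D M (\<lambda>x. x * poly (orthopoly D M k) x) (poly (orthopoly D M k)) /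
     inner_mu D M (poly (orthopoly D M k)) (poly (orthopoly D M k))"

definition rec_beta :: "real set \<Rightarrow> real measure \<Rightarrow> nat \<Rightarrow> real" where
  "rec_beta D M k =
     (if k = 0 then inner_mu D M (poly (orthopoly D M 0)) (poly (orthopoly D M 0))
      else inner_mu D M (poly (orthopoly D M k)) (poly (orthopoly D M k)) /
           inner_mu D M (poly (orthopoly D M (k - 1))) (poly (orthopoly D M (k - 1))))"

text \<open>Matrix and vector indices start at 0.\<close>

definition jacobi_mat :: "real set \<Rightarrow> real measure \<Rightarrow> nat \<Rightarrow> real mat" where
  "jacobi_mat D M m = Matrix.mat m m (\<lambda>(i, j).
     if i = j then rec_alpha D M i
     else if j = i + 1 then sqrt (rec_beta D M j)
     else if i = j + 1 then sqrt (rec_beta D M i)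
     else 0)"

text \<open>The bordered matrix of size \<open>m + 1\<close>, for \<open>m \<ge> 1\<close>.\<close>

definition jacobi_star_mat :: "real set \<Rightarrow> real measure \<Rightarrow> nat \<Rightarrow> real mat" where
  "jacobi_star_mat D M m =
     (let w = sqrt (rec_beta D M m + rec_beta D M (m + 1)) \<cdot>\<^sub>v unit_vec m (m - 1) in
      four_block_mat (jacobi_mat D M m) (mat_of_cols m [w])
                     (mat_of_rows m [w]) (Matrix.mat 1 1 (\<lambda>_. rec_alpha D M m)))"

text \<open>The eigenvalues in increasing order, numbered \<open>k = 1, \<dots>, m + 1\<close>.\<close>

definition star_node :: "real set \<Rightarrow> real measure \<Rightarrow> nat \<Rightarrow> nat \<Rightarrow> real" where
  "star_node D M m k =
     sorted_list_of_set {t. eigenvalue (jacobi_star_mat D M m) t} ! (k - 1)"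

text \<open>The eigenspaces are one-dimensional, so a normalized real eigenvector is unique up to sign and
  its choice does not affect the weight.\<close>

definition star_weight :: "real set \<Rightarrow> real measure \<Rightarrow> nat \<Rightarrow> nat \<Rightarrow> real" where
  "star_weight D M m k =
     (let v = (SOME v. eigenvector (jacobi_star_mat D M m) v (star_node D M m k) \<and>
                       scalar_prod v v = 1)
      in rec_beta D M 0 * (vec_index v 0)\<^sup>2)"

definition star_rule :: "real set \<Rightarrow> real measure \<Rightarrow> nat \<Rightarrow> (real \<Rightarrow> real) \<Rightarrow> real" where
  "star_rule D M m f = (\<Sum>k=1..m+1. star_weight D M m k * f (star_node D M m k))"

definition star_poly :: "real set \<Rightarrow> real measure \<Rightarrow> nat \<Rightarrow> real poly" where
  "star_poly D M m = (\<Prod>k=1..m+1. [:- star_node D M m k, 1:])"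

definition q_poly :: "real set \<Rightarrow> real measure \<Rightarrow> nat \<Rightarrow> real poly" where
  "q_poly D M m = orthopoly D M m * star_poly D M m"

end

theory Submission
  imports Defs
begin

text \<open>
  The matrix \<open>J\<^sup>*\<^sub>m\<^sub>+\<^sub>1\<close> is itself a Jacobi matrix: it belongs to the recurrence coefficients
  \<open>\<alpha>\<close> and \<open>\<beta>'\<close>, where \<open>\<beta>'\<close> agrees with \<open>\<beta>\<close> except for \<open>\<beta>'\<^sub>m = \<beta>\<^sub>m + \<beta>\<^sub>m\<^sub>+\<^sub>1\<close>. The polynomials \<open>r\<^sub>i\<close> of the
  modified recurrence are the old \<open>p\<^sub>i\<close> for \<open>i \<le> m\<close>, because \<open>\<beta>\<^sub>m\<close> first enters in \<open>p\<^sub>m\<^sub>+\<^sub>1\<close>. All claims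
  are therefore general facts about an \<open>(m+1) \<times> (m+1)\<close> Jacobi matrix with positive coefficients,
  followed by a comparison of two consecutive degrees.

  An eigenvector for \<open>t\<close> must satisfy the three-term recurrence row by row, so it is a multiple of
  \<open>(r\<^sub>i(t) / \<surd>h\<^sub>i)\<^sub>i\<close> with \<open>h\<^sub>i = \<beta>'\<^sub>0 \<cdots> \<beta>'\<^sub>i\<close>, and the last row says \<open>r\<^sub>m\<^sub>+\<^sub>1(t) = 0\<close>
  (\<open>eigenvector_jacobi_matrix\<close>). Normalizing it turns the weight into the Christoffel number
  \<open>1 / \<Sum>\<^sub>i r\<^sub>i(t)\<^sup>2 / h\<^sub>i\<close>, which the confluent Christoffel--Darboux identity evaluates to
  \<open>h\<^sub>m / (r\<^sub>m(t) r'\<^sub>m\<^sub>+\<^sub>1(t))\<close>. Here \<open>h\<^sub>m = (\<beta>'\<^sub>m / \<beta>\<^sub>m) \<parallel>p\<^sub>m\<parallel>\<^sup>2\<close>, and \<open>r\<^sub>m r'\<^sub>m\<^sub>+\<^sub>1\<close> is the derivative of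
  \<open>r\<^sub>m r\<^sub>m\<^sub>+\<^sub>1\<close> at a zero of \<open>r\<^sub>m\<^sub>+\<^sub>1\<close>: this is the weight formula.

  The zeros of consecutive \<open>r\<^sub>n\<close> are real and interlace by induction (\<open>interlacing_roots\<close>): at the
  zeros of \<open>r\<^sub>n\<^sub>+\<^sub>1\<close> the recurrence gives \<open>r\<^sub>n\<^sub>+\<^sub>2\<close> the sign opposite to that of \<open>r\<^sub>n\<close>, so \<open>r\<^sub>n\<^sub>+\<^sub>2\<close>
  changes sign \<open>n + 2\<close> times.

  For exactness, the Christoffel--Darboux identity says that a certain square matrix built from the
  node values has orthonormal rows. Its columns are then orthonormal too, which is orthogonality of
  \<open>r\<^sub>0, \<dots>, r\<^sub>m\<close> for the discrete rule (\<open>discrete_orthogonality\<close>). The rule and the integral thus agree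
  on \<open>r\<^sub>j\<close> and \<open>r\<^sub>m r\<^sub>j\<close> for \<open>j < m\<close>: these have the degrees \<open>0, \<dots>, 2m - 1\<close> and span all polynomials of
  degree at most \<open>2m - 1\<close>. In degree \<open>2m\<close> the agreement stops, as \<open>r\<^sub>m\<^sup>2\<close> has the changed value \<open>h\<^sub>m\<close>.
\<close>

section \<open>Three-term recurrences and the Christoffel--Darboux identity\<close>

fun rec_poly :: "(nat \<Rightarrow> real) \<Rightarrow> (nat \<Rightarrow> real) \<Rightarrow> nat \<Rightarrow> real poly" where
  "rec_poly a b 0 = 1"
| "rec_poly a b (Suc 0) = [:- a 0, 1:]"
| "rec_poly a b (Suc (Suc n)) = [:- a (Suc n), 1:] * rec_poly a b (Suc n) - Polynomial.smult (b (Suc n)) (rec_poly a b n)"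

lemma rec_poly_cong:
  assumes "\<And>i. i < n \<Longrightarrow> a i = a' i" "\<And>i. i < n \<Longrightarrow> b i = b' i"
  shows "rec_poly a b n = rec_poly a' b' n"
  using assms
proof (induction n rule: less_induct)
  case (less n)
  show ?case
  proof (cases "n < 2")
    case True
    then have "n = 0 \<or> n = Suc 0" by auto
    then show ?thesis using less.prems by auto
  next
    case False
    then obtain k where n: "n = Suc (Suc k)" by (metis add_2_eq_Suc le_Suc_ex not_less)
    have "rec_poly a b (Suc k) = rec_poly a' b' (Suc k)" "rec_poly a b k = rec_poly a' b' k"
      by (intro less.IH; use less.prems n in simp)+
    then show ?thesis using less.prems n by simp
  qed
qed

lemma degree_lead_coeff_rec_poly: "degree (rec_poly a b n) = n \<and> lead_coeff (rec_poly a b n) = 1"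
proof (induction n rule: less_induct)
  case (less n)
  show ?case
  proof (cases "n < 2")
    case True
    then have "n = 0 \<or> n = Suc 0" by auto
    then show ?thesis by auto
  next
    case False
    then obtain k where n: "n = Suc (Suc k)" by (metis add_2_eq_Suc le_Suc_ex not_less)
    let ?q = "[:- a (Suc k), 1:] * rec_poly a b (Suc k)"
    have IH: "degree (rec_poly a b (Suc k)) = Suc k" "lead_coeff (rec_poly a b (Suc k)) = 1"
        "degree (rec_poly a b k) = k"
      using less.IH[of "Suc k"] less.IH[of k] n by auto
    have q: "degree ?q = n"
      using IH n by (subst degree_mult_eq) auto
    have lq: "lead_coeff ?q = 1"
      using IH(2) by (simp only: lead_coeff_mult) simp
    have s: "degree (- Polynomial.smult (b (Suc k)) (rec_poly a b k)) < degree ?q"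
      using IH q n by (simp add: le_imp_less_Suc)
    have "rec_poly a b n = ?q + - Polynomial.smult (b (Suc k)) (rec_poly a b k)" using n by simp
    then show ?thesis using q lq s degree_add_eq_left[OF s] lead_coeff_add_le[OF s]
      by (metis add.commute coeff_add coeff_eq_0 add_0)
  qed
qed

lemma degree_rec_poly [simp]: "degree (rec_poly a b n) = n"
  and lead_coeff_rec_poly [simp]: "coeff (rec_poly a b n) n = 1"
  using degree_lead_coeff_rec_poly[of a b n] by auto

text \<open>The diagonal of the Jacobi matrix is \<open>a\<close> and its off-diagonal entries are \<open>\<surd>(b i)\<close> for \<open>i \<ge> 1\<close>. The
  coefficient \<open>b 0\<close> is the total mass of the measure and only scales the squared norms.\<close>
locale jacobi_recurrence =
  fixes a b :: "nat \<Rightarrow> real"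
  assumes b_pos: "\<And>i. b i > 0"
begin

text \<open>The squared norm of \<open>rec_poly a b n\<close> for a measure of total mass \<open>b 0\<close> whose recurrence
  coefficients are \<open>a\<close> and \<open>b\<close>.\<close>
definition sqnorm :: "nat \<Rightarrow> real" where
  "sqnorm n = (\<Prod>i\<le>n. b i)"

lemma sqnorm_pos: "sqnorm n > 0"
  unfolding sqnorm_def by (intro prod_pos) (auto intro: b_pos)

lemma sqnorm_Suc: "sqnorm (Suc n) = b (Suc n) * sqnorm n"
  by (simp add: sqnorm_def)

lemma sqnorm_0: "sqnorm 0 = b 0"
  by (simp add: sqnorm_def)

lemma christoffel_darboux:
  "(x - y) * (\<Sum>i\<le>n. poly (rec_poly a b i) x * poly (rec_poly a b i) y / sqnorm i) =
   (poly (rec_poly a b (Suc n)) x * poly (rec_poly a b n) y - poly (rec_poly a b n) x * poly (rec_poly a b (Suc n)) y)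
     / sqnorm n"
proof (induction n)
  case 0
  then show ?case by simp
next
  case (Suc n)
  have "b (Suc n) \<noteq> 0" "sqnorm n \<noteq> 0"
    using b_pos[of "Suc n"] sqnorm_pos[of n] by auto
  then show ?case
    by (simp add: Suc distrib_left sqnorm_Suc del: times_divide_eq_right) (simp add: field_simps)
qed

text \<open>The limit \<open>y \<rightarrow> x\<close> of the preceding identity. Differentiating the recurrence gives it directly, by
  the same induction.\<close>
lemma christoffel_darboux_confluent:
  "(\<Sum>i\<le>n. (poly (rec_poly a b i) x)\<^sup>2 / sqnorm i) =
   (poly (pderiv (rec_poly a b (Suc n))) x * poly (rec_poly a b n) x
      - poly (pderiv (rec_poly a b n)) x * poly (rec_poly a b (Suc n)) x) / sqnorm n"
proof (induction n)
  case 0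
  then show ?case by (simp add: pderiv_pCons)
next
  case (Suc n)
  have "b (Suc n) \<noteq> 0" "sqnorm n \<noteq> 0"
    using b_pos[of "Suc n"] sqnorm_pos[of n] by auto
  then show ?case
    by (simp add: Suc[unfolded power2_eq_square] sqnorm_Suc pderiv_diff pderiv_mult pderiv_smult pderiv_pCons power2_eq_square)
      (simp add: field_simps)
qed

definition christoffel :: "nat \<Rightarrow> real \<Rightarrow> real" where
  "christoffel n x = 1 / (\<Sum>i\<le>n. (poly (rec_poly a b i) x)\<^sup>2 / sqnorm i)"

lemma christoffel_pos: "christoffel n x > 0"
proof -
  have "(\<Sum>i\<le>n. (poly (rec_poly a b i) x)\<^sup>2 / sqnorm i) \<ge> (poly (rec_poly a b 0) x)\<^sup>2 / sqnorm 0"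
    by (rule member_le_sum) (auto intro: divide_nonneg_pos sqnorm_pos)
  moreover have "(poly (rec_poly a b 0) x)\<^sup>2 / sqnorm 0 > 0" using sqnorm_pos[of 0] by simp
  ultimately have "(\<Sum>i\<le>n. (poly (rec_poly a b i) x)\<^sup>2 / sqnorm i) > 0" by (rule less_le_trans[rotated])
  then show ?thesis unfolding christoffel_def by simp
qed

text \<open>At a zero of the next polynomial the second product in the confluent Christoffel--Darboux identity
  vanishes. This is the source of the closed formula for the weights.\<close>
lemma christoffel_eq:
  assumes "poly (rec_poly a b (Suc n)) x = 0"
  shows "christoffel n x = sqnorm n / (poly (rec_poly a b n) x * poly (pderiv (rec_poly a b (Suc n))) x)"
  using assms unfolding christoffel_def christoffel_darboux_confluent by simp

end

section \<open>Real and interlacing zeros\<close>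

lemma strict_mono_on_nat_intervalI:
  fixes f :: "nat \<Rightarrow> 'a :: order"
  assumes "\<And>k. m \<le> k \<Longrightarrow> Suc k \<le> n \<Longrightarrow> f k < f (Suc k)"
  shows "strict_mono_on {m..n} f"
proof (rule strict_mono_onI)
  fix r s assume rs: "r \<in> {m..n}" "s \<in> {m..n}" "r < s"
  have "Suc r \<le> s" using rs by simp
  then have "s \<le> n \<longrightarrow> f r < f s"
  proof (induction rule: dec_induct)
    case base
    show ?case using assms[of r] rs by simp
  next
    case (step k)
    then show ?case using assms[of k] rs by force
  qed
  then show "f r < f s" using rs by simp
qed

lemma monic_eq_prod_roots:
  fixes p :: "'a :: field poly"
  assumes "finite A" "inj_on u A" "\<And>k. k \<in> A \<Longrightarrow> poly p (u k) = 0"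
    and "degree p = card A" "lead_coeff p = 1"
  shows "p = (\<Prod>k\<in>A. [:- u k, 1:])"
proof (rule ccontr)
  let ?r = "\<Prod>k\<in>A. [:- u k, 1:]"
  assume "p \<noteq> ?r"
  then have nz: "p - ?r \<noteq> 0" by simp
  have deg: "degree ?r = card A"
    by (subst degree_prod_eq_sum_degree) auto
  have lc: "lead_coeff ?r = 1" by (simp add: lead_coeff_prod)
  have "card A > 0"
  proof (rule ccontr)
    assume "\<not> card A > 0"
    then have "A = {}" using assms(1) by auto
    then have "degree p = 0" using assms(4) by simp
    then obtain c where "p = [:c:]" by (rule degree_eq_zeroE)
    then show False using assms(5) nz \<open>A = {}\<close> by (simp add: one_pCons)
  qed
  have "degree (p - ?r) < card A"
  proof (rule le_neq_implies_less)
    show "degree (p - ?r) \<le> card A" by (rule degree_diff_le) (use assms(4) deg in auto)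
    have "coeff (p - ?r) (card A) = 0" using assms(4,5) deg lc by simp
    then show "degree (p - ?r) \<noteq> card A" using nz leading_coeff_0_iff by metis
  qed
  moreover have "card A \<le> card {x. poly (p - ?r) x = 0}"
  proof -
    have "card A = card (u ` A)" using assms(2) by (simp add: card_image)
    also have "\<dots> \<le> card {x. poly (p - ?r) x = 0}"
      by (intro card_mono poly_roots_finite nz) (use assms(1,3) in \<open>auto simp: poly_prod\<close>)
    finally show ?thesis .
  qed
  moreover have "card {x. poly (p - ?r) x = 0} \<le> degree (p - ?r)"
    by (rule card_poly_roots_bound[OF nz])
  ultimately show False by linarith
qed

text \<open>The intermediate value theorem supplies one zero in each of the \<open>n\<close> gaps, and a polynomial of degree
  \<open>n\<close> has no others. The separation of the zeros by the sample points \<open>w\<close> is recorded, since the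
  interlacing comes from it.\<close>
lemma sign_changes_imp_interlacing_roots:
  fixes p :: "real poly"
  assumes deg: "degree p = n" and lc: "lead_coeff p = 1"
    and w: "\<And>k. k < n \<Longrightarrow> w k < w (Suc k)"
    and sgn: "\<And>k. k \<le> n \<Longrightarrow> (-1) ^ (n - k) * poly p (w k) > 0"
  obtains u where "strict_mono_on {1..n} u" "p = (\<Prod>k=1..n. [:- u k, 1:])"
    "\<And>k. k \<in> {1..n} \<Longrightarrow> w (k - 1) < u k \<and> u k < w k"
proof -
  have "\<exists>x. w (k - 1) < x \<and> x < w k \<and> poly p x = 0" if k: "k \<in> {1..n}" for k
  proof -
    let ?e = "(-1) ^ (n - k) :: real"
    have "n - (k - 1) = Suc (n - k)" using k by auto
    then have "?e * poly p (w (k - 1)) < 0" using sgn[of "k - 1"] k by auto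
    moreover have "?e * poly p (w k) > 0" using sgn[of k] k by auto
    moreover have "w (k - 1) < w k" using w[of "k - 1"] k by auto
    ultimately obtain x where "w (k - 1) < x" "x < w k" "poly (Polynomial.smult ?e p) x = 0"
      using poly_IVT_pos[of "w (k - 1)" "w k" "Polynomial.smult ?e p"] by auto
    then show ?thesis by auto
  qed
  then obtain u where u: "\<And>k. k \<in> {1..n} \<Longrightarrow> w (k - 1) < u k \<and> u k < w k \<and> poly p (u k) = 0"
    by metis
  have mono: "strict_mono_on {1..n} u"
  proof (rule strict_mono_on_nat_intervalI)
    fix k assume "1 \<le> k" "Suc k \<le> n"
    then show "u k < u (Suc k)" using u[of k] u[of "Suc k"] by auto
  qed
  have "p = (\<Prod>k=1..n. [:- u k, 1:])"
    by (rule monic_eq_prod_roots) (use u deg lc strict_mono_on_imp_inj_on[OF mono] in auto)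
  then show ?thesis using that[of u] mono u by auto
qed

text \<open>Each of the \<open>n - k\<close> zeros to the right of \<open>t\<close> contributes one negative factor.\<close>
lemma sign_prod_roots:
  fixes z :: "nat \<Rightarrow> real"
  assumes "k \<le> n" "\<And>j. 1 \<le> j \<Longrightarrow> j \<le> k \<Longrightarrow> z j < t" "\<And>j. k < j \<Longrightarrow> j \<le> n \<Longrightarrow> t < z j"
  shows "(-1) ^ (n - k) * (\<Prod>j=1..n. t - z j) > 0"
proof -
  have "{1..n} = {1..k} \<union> {k<..n}" using assms(1) by auto
  then have "(\<Prod>j=1..n. t - z j) = (\<Prod>j=1..k. t - z j) * (\<Prod>j\<in>{k<..n}. t - z j)"
    by (simp only:) (rule prod.union_disjoint; auto)
  moreover have "(\<Prod>j=1..k. t - z j) > 0" using assms(2) by (intro prod_pos) auto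
  moreover have "(-1) ^ (n - k) * (\<Prod>j\<in>{k<..n}. t - z j) = (\<Prod>j\<in>{k<..n}. z j - t)"
  proof -
    have "(\<Prod>j\<in>{k<..n}. z j - t) = (\<Prod>j\<in>{k<..n}. (- 1) * (t - z j))" by simp
    also have "\<dots> = (\<Prod>j\<in>{k<..n}. - 1) * (\<Prod>j\<in>{k<..n}. t - z j)" by (rule prod.distrib)
    finally show ?thesis by simp
  qed
  moreover have "(\<Prod>j\<in>{k<..n}. z j - t) > 0" using assms(3) by (intro prod_pos) auto
  ultimately show ?thesis by (metis mult.left_commute mult_pos_pos)
qed

text \<open>Supplies the two outermost sample points of the sign-change argument.\<close>
lemma monic_sign_at_infinity:
  fixes p :: "real poly"
  assumes "lead_coeff p = 1"
  obtains x y where "x < c" "d < y" "(-1) ^ degree p * poly p x > 0" "poly p y > 0"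
proof -
  obtain y0 where y0: "\<And>x. x \<ge> y0 \<Longrightarrow> poly p x \<ge> 1"
    using poly_pinfty_gt_lc[of p] assms by auto
  define r where "r = Polynomial.smult ((-1) ^ degree p) (pcompose p [:0, -1:])"
  have dr: "degree (pcompose p [:0, -1:]) = degree p" by simp
  have "lead_coeff (pcompose p [:0, -1:]) = (-1) ^ degree p"
    using lead_coeff_comp[of "[:0, -1:]" p] assms by simp
  then have "lead_coeff r = 1" unfolding r_def by (simp flip: power_mult_distrib)
  then obtain x0 where x0: "\<And>x. x \<ge> x0 \<Longrightarrow> poly r x \<ge> 1"
    using poly_pinfty_gt_lc[of r] by auto
  show ?thesis
  proof (rule that[of "min (c - 1) (- x0)" "max (d + 1) y0"])
    show "(-1) ^ degree p * poly p (min (c - 1) (- x0)) > 0"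
    proof -
      have "x0 \<le> - min (c - 1) (- x0)" by simp
      from x0[OF this] show ?thesis by (simp add: r_def poly_pcompose)
    qed
    show "poly p (max (d + 1) y0) > 0" using y0[of "max (d + 1) y0"] by simp
  qed auto
qed

context jacobi_recurrence begin

text \<open>At a zero of \<open>r\<^sub>n\<^sub>+\<^sub>1\<close> the recurrence reduces to \<open>r\<^sub>n\<^sub>+\<^sub>2 = - b\<^sub>n\<^sub>+\<^sub>1 r\<^sub>n\<close>. By the interlacing of \<open>r\<^sub>n\<close> and
  \<open>r\<^sub>n\<^sub>+\<^sub>1\<close> the values of \<open>r\<^sub>n\<close> at these zeros alternate in sign, hence so do those of \<open>r\<^sub>n\<^sub>+\<^sub>2\<close>. One point
  far out on each side adds the two missing sign changes.\<close>
lemma interlacing_roots: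
  obtains z w where
    "strict_mono_on {1..n} z" "rec_poly a b n = (\<Prod>k=1..n. [:- z k, 1:])"
    "strict_mono_on {1..Suc n} w" "rec_poly a b (Suc n) = (\<Prod>k=1..Suc n. [:- w k, 1:])"
    "\<And>k. k \<in> {1..n} \<Longrightarrow> w k < z k \<and> z k < w (Suc k)"
proof -
  have "\<exists>z w. strict_mono_on {1..n} z \<and> rec_poly a b n = (\<Prod>k=1..n. [:- z k, 1:]) \<and>
    strict_mono_on {1..Suc n} w \<and> rec_poly a b (Suc n) = (\<Prod>k=1..Suc n. [:- w k, 1:]) \<and>
    (\<forall>k\<in>{1..n}. w k < z k \<and> z k < w (Suc k))"
  proof (induction n)
    case 0
    show ?case by (intro exI[of _ a] exI[of _ "\<lambda>_. a 0"]) (simp add: strict_mono_on_def)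
  next
    case (Suc n)
    then obtain z w where z: "strict_mono_on {1..n} z" "rec_poly a b n = (\<Prod>k=1..n. [:- z k, 1:])"
      and w: "strict_mono_on {1..Suc n} w" "rec_poly a b (Suc n) = (\<Prod>k=1..Suc n. [:- w k, 1:])"
      and zw: "\<And>k. k \<in> {1..n} \<Longrightarrow> w k < z k \<and> z k < w (Suc k)" by blast
    let ?p = "rec_poly a b (Suc (Suc n))"
    \<comment> \<open>points beyond the extreme zeros where the sign of \<open>r\<^sub>n\<^sub>+\<^sub>2\<close> is that of its leading term\<close>
    obtain x y where xy: "x < w 1" "w (Suc n) < y" "(-1) ^ Suc (Suc n) * poly ?p x > 0" "poly ?p y > 0"
      by (rule monic_sign_at_infinity[of ?p "w 1" "w (Suc n)"]) (simp_all del: rec_poly.simps)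
    define v where "v k = (if k = 0 then x else if k = Suc (Suc n) then y else w k)" for k
    have less: "v k < v (Suc k)" if "k < Suc (Suc n)" for k
      using that xy strict_mono_onD[OF w(1), of k "Suc k"] by (auto simp: v_def)
    have sgn: "(-1) ^ (Suc (Suc n) - k) * poly ?p (v k) > 0" if k: "k \<le> Suc (Suc n)" for k
    proof (cases "k = 0 \<or> k = Suc (Suc n)")
      case True
      then show ?thesis using xy by (auto simp: v_def)
    next
      case False
      then have k': "k \<in> {1..Suc n}" using k by auto
      have "poly (rec_poly a b (Suc n)) (w k) = 0"
        unfolding w(2) poly_prod by (rule prod_zero) (use k' in auto)
      then have p: "poly ?p (w k) = - b (Suc n) * poly (rec_poly a b n) (w k)" by simp
      have "(-1) ^ (n - (k - 1)) * (\<Prod>j=1..n. w k - z j) > 0"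
      proof (rule sign_prod_roots)
        show "k - 1 \<le> n" using k' by auto
        fix j
        show "z j < w k" if "1 \<le> j" "j \<le> k - 1"
        proof -
          have "z j \<le> z (k - 1)" using that k' z(1) by (auto intro!: strict_mono_on_leD[OF z(1)])
          also have "\<dots> < w k" using zw[of "k - 1"] that k' by auto
          finally show ?thesis .
        qed
        show "w k < z j" if "k - 1 < j" "j \<le> n"
        proof -
          have "w k < z k" using zw[of k] that k' by auto
          also have "z k \<le> z j" using that k' by (auto intro!: strict_mono_on_leD[OF z(1)])
          finally show ?thesis .
        qed
      qed
      then have "(-1) ^ (n - (k - 1)) * poly (rec_poly a b n) (w k) > 0"
        unfolding z(2) by (simp add: poly_prod)
      moreover have "Suc (Suc n) - k = Suc (n - (k - 1))" using k' by auto
      ultimately show ?thesis using False b_pos[of "Suc n"]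
        by (simp add: v_def p mult.left_commute del: rec_poly.simps)
    qed
    obtain u where u: "strict_mono_on {1..Suc (Suc n)} u"
        "?p = (\<Prod>k=1..Suc (Suc n). [:- u k, 1:])"
        "\<And>k. k \<in> {1..Suc (Suc n)} \<Longrightarrow> v (k - 1) < u k \<and> u k < v k"
      by (rule sign_changes_imp_interlacing_roots[of ?p "Suc (Suc n)" v])
        (use less sgn in \<open>auto simp del: rec_poly.simps\<close>)
    have "u k < w k \<and> w k < u (Suc k)" if "k \<in> {1..Suc n}" for k
      using u(3)[of k] u(3)[of "Suc k"] that by (auto simp: v_def)
    then show ?case using u w by blast
  qed
  then show ?thesis using that by blast
qed

end

section \<open>Eigenvectors of Jacobi matrices\<close>

definition jacobi_matrix :: "(nat \<Rightarrow> real) \<Rightarrow> (nat \<Rightarrow> real) \<Rightarrow> nat \<Rightarrow> real mat" where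
  "jacobi_matrix a b n = Matrix.mat n n (\<lambda>(i, j).
     if i = j then a i
     else if j = i + 1 then sqrt (b j)
     else if i = j + 1 then sqrt (b i)
     else 0)"

lemma jacobi_matrix_mult_vec:
  assumes v: "v \<in> carrier_vec n" and i: "i < n"
  shows "vec_index (jacobi_matrix a b n *\<^sub>v v) i = a i * vec_index v i
    + (if Suc i < n then sqrt (b (Suc i)) * vec_index v (Suc i) else 0)
    + (if 0 < i then sqrt (b i) * vec_index v (i - 1) else 0)"
proof -
  have "vec_index (jacobi_matrix a b n *\<^sub>v v) i =
      (\<Sum>j<n. (if j = i then a i * vec_index v i else 0)
        + (if j = Suc i then sqrt (b (Suc i)) * vec_index v (Suc i) else 0)
        + (if j = i - 1 then (if 0 < i then sqrt (b i) * vec_index v (i - 1) else 0) else 0))"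
    using v i by (auto simp: jacobi_matrix_def scalar_prod_def lessThan_atLeast0 intro!: sum.cong)
  also have "\<dots> = a i * vec_index v i
    + (if Suc i < n then sqrt (b (Suc i)) * vec_index v (Suc i) else 0)
    + (if 0 < i then sqrt (b i) * vec_index v (i - 1) else 0)"
    using i by (simp add: sum.distrib)
  finally show ?thesis .
qed

context jacobi_recurrence begin

text \<open>The values at \<open>t\<close> of the orthonormal polynomials; in this scaling the recurrence becomes symmetric
  and reads off the rows of the Jacobi matrix.\<close>
definition orthonormal :: "real \<Rightarrow> nat \<Rightarrow> real" where
  "orthonormal t i = poly (rec_poly a b i) t / sqrt (sqnorm i)"

lemma orthonormal_0: "orthonormal t 0 = 1 / sqrt (b 0)"
  by (simp add: orthonormal_def sqnorm_0)

lemma orthonormal_eq_0_iff: "orthonormal t i = 0 \<longleftrightarrow> poly (rec_poly a b i) t = 0"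
  using sqnorm_pos[of i] by (simp add: orthonormal_def)

lemma orthonormal_square: "(orthonormal t i)\<^sup>2 = (poly (rec_poly a b i) t)\<^sup>2 / sqnorm i"
  using sqnorm_pos[of i] by (simp add: orthonormal_def power_divide)

lemma orthonormal_recurrence:
  "t * orthonormal t i = a i * orthonormal t i + sqrt (b (Suc i)) * orthonormal t (Suc i)
     + (if 0 < i then sqrt (b i) * orthonormal t (i - 1) else 0)"
proof (cases i)
  case 0
  have "b (Suc 0) \<noteq> 0" using b_pos[of "Suc 0"] by simp
  then show ?thesis using 0
    by (simp add: orthonormal_def sqnorm_def real_sqrt_mult diff_divide_distrib right_diff_distrib)
next
  case (Suc k)
  have sq: "sqrt (b j) \<noteq> 0" "sqrt (sqnorm j) \<noteq> 0" "b j = sqrt (b j) * sqrt (b j)" for j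
    using b_pos[of j] sqnorm_pos[of j] by auto
  have "sqrt (b (Suc i)) * orthonormal t (Suc i) = poly (rec_poly a b (Suc i)) t / sqrt (sqnorm i)"
    using sq(1)[of "Suc i"] by (simp add: orthonormal_def sqnorm_Suc real_sqrt_mult del: rec_poly.simps)
  moreover have "sqrt (b i) * orthonormal t (i - 1) = b i * poly (rec_poly a b k) t / sqrt (sqnorm i)"
    using b_pos[of i] sqnorm_pos[of k]
    by (simp add: Suc orthonormal_def sqnorm_Suc real_sqrt_mult field_simps del: rec_poly.simps)
  moreover have "poly (rec_poly a b (Suc i)) t = (t - a i) * poly (rec_poly a b i) t - b i * poly (rec_poly a b k) t"
    by (simp add: Suc algebra_simps)
  ultimately show ?thesis using Suc sq(2)[of i]
    by (simp add: orthonormal_def field_simps del: rec_poly.simps)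
qed

text \<open>Row \<open>i\<close> of the eigenvalue equation determines entry \<open>i + 1\<close> from the two entries before it, in the
  same way as the recurrence does, so the first entry fixes the whole vector. In the last row the term
  with index \<open>m + 1\<close> is missing, which forces it to vanish.\<close>
lemma eigenvector_jacobi_matrix:
  assumes ev: "eigenvector (jacobi_matrix a b (Suc m)) v t"
  defines "c \<equiv> vec_index v 0 * sqrt (b 0)"
  shows "\<And>i. i \<le> m \<Longrightarrow> vec_index v i = c * orthonormal t i"
    and "poly (rec_poly a b (Suc m)) t = 0"
proof -
  let ?J = "jacobi_matrix a b (Suc m)"
  have v: "v \<in> carrier_vec (Suc m)" "v \<noteq> 0\<^sub>v (Suc m)" and "?J *\<^sub>v v = t \<cdot>\<^sub>v v"
    using ev by (auto simp: eigenvector_def jacobi_matrix_def)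
  then have row: "t * vec_index v i = a i * vec_index v i
     + (if Suc i < Suc m then sqrt (b (Suc i)) * vec_index v (Suc i) else 0)
     + (if 0 < i then sqrt (b i) * vec_index v (i - 1) else 0)" if "i \<le> m" for i
    using jacobi_matrix_mult_vec[OF v(1), of i a b] that by simp
  show eq: "vec_index v i = c * orthonormal t i" if "i \<le> m" for i
    using that
  proof (induction i rule: less_induct)
    case (less i)
    show ?case
    proof (cases i)
      case 0
      then show ?thesis using b_pos[of 0] by (simp add: c_def orthonormal_0)
    next
      case (Suc k)
      have k: "vec_index v k = c * orthonormal t k"
        "0 < k \<Longrightarrow> vec_index v (k - 1) = c * orthonormal t (k - 1)"
        using less Suc by auto
      have "sqrt (b (Suc k)) * vec_index v (Suc k) =
          c * (t * orthonormal t k - a k * orthonormal t k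
            - (if 0 < k then sqrt (b k) * orthonormal t (k - 1) else 0))"
        using row[of k] k less.prems Suc by (auto simp: algebra_simps)
      also have "\<dots> = sqrt (b (Suc k)) * (c * orthonormal t (Suc k))"
        by (subst orthonormal_recurrence) simp
      finally show ?thesis using Suc b_pos[of "Suc k"] by simp
    qed
  qed
  have "c \<noteq> 0"
  proof
    assume "c = 0"
    then have "v = 0\<^sub>v (Suc m)" using v(1) eq by (intro eq_vecI) auto
    then show False using v(2) by simp
  qed
  have "c * (t * orthonormal t m) = c * (a m * orthonormal t m
     + (if 0 < m then sqrt (b m) * orthonormal t (m - 1) else 0))"
    using row[of m] eq[of m] eq[of "m - 1"] by (auto simp: algebra_simps)
  then have "c * (sqrt (b (Suc m)) * orthonormal t (Suc m)) = 0"
    by (subst (asm) orthonormal_recurrence) (simp add: algebra_simps)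
  then show "poly (rec_poly a b (Suc m)) t = 0"
    using \<open>c \<noteq> 0\<close> b_pos[of "Suc m"] by (simp add: orthonormal_eq_0_iff del: rec_poly.simps)
qed

lemma normalized_eigenvector_exists:
  assumes "poly (rec_poly a b (Suc m)) t = 0"
  shows "\<exists>v. eigenvector (jacobi_matrix a b (Suc m)) v t \<and> scalar_prod v v = 1"
proof -
  define c where "c = sqrt (christoffel m t)"
  define v where "v = Matrix.vec (Suc m) (\<lambda>i. c * orthonormal t i)"
  have c: "c > 0" "c\<^sup>2 = christoffel m t"
    using christoffel_pos[of m t] by (simp_all add: c_def)
  have v: "v \<in> carrier_vec (Suc m)" by (simp add: v_def)
  have vi: "vec_index v i = c * orthonormal t i" if "i \<le> m" for i
    using that by (simp add: v_def)
  have "jacobi_matrix a b (Suc m) *\<^sub>v v = t \<cdot>\<^sub>v v"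
  proof (rule eq_vecI)
    fix i assume "i < dim_vec (t \<cdot>\<^sub>v v)"
    then have i: "i < Suc m" by (simp add: v_def)
    have prev: "vec_index v (i - 1) = c * orthonormal t (i - 1)" using i by (simp add: v_def)
    have "vec_index (t \<cdot>\<^sub>v v) i = c * (t * orthonormal t i)" using i by (simp add: v_def)
    also have "\<dots> = vec_index (jacobi_matrix a b (Suc m) *\<^sub>v v) i"
      using i assms orthonormal_eq_0_iff[of t "Suc m"] prev
      by (subst orthonormal_recurrence, subst jacobi_matrix_mult_vec[OF v])
        (auto simp: vi algebra_simps less_Suc_eq simp del: rec_poly.simps)
    finally show "vec_index (jacobi_matrix a b (Suc m) *\<^sub>v v) i = vec_index (t \<cdot>\<^sub>v v) i" by simp
  qed (simp add: v_def jacobi_matrix_def)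
  moreover have "v \<noteq> 0\<^sub>v (Suc m)"
  proof
    assume "v = 0\<^sub>v (Suc m)"
    then have "vec_index v 0 = 0" by simp
    then show False using c b_pos[of 0] by (simp add: v_def orthonormal_0)
  qed
  moreover have "scalar_prod v v = c\<^sup>2 * (\<Sum>i\<le>m. (poly (rec_poly a b i) t)\<^sup>2 / sqnorm i)"
  proof -
    have "scalar_prod v v = (\<Sum>i\<le>m. (c * orthonormal t i)\<^sup>2)"
      by (simp add: v_def scalar_prod_def lessThan_atLeast0[symmetric] lessThan_Suc_atMost
          power2_eq_square)
    then show ?thesis
      by (simp add: sum_distrib_left orthonormal_square[symmetric] power_mult_distrib)
  qed
  then have "scalar_prod v v = 1"
    using c christoffel_pos[of m t] unfolding christoffel_def by (auto simp: field_simps)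
  ultimately show ?thesis using v by (auto simp: eigenvector_def jacobi_matrix_def)
qed

lemma eigenvalue_jacobi_matrix_iff:
  "eigenvalue (jacobi_matrix a b (Suc m)) t \<longleftrightarrow> poly (rec_poly a b (Suc m)) t = 0"
  using eigenvector_jacobi_matrix(2) normalized_eigenvector_exists
  unfolding eigenvalue_def by blast

text \<open>By \<open>eigenvector_jacobi_matrix\<close> the weight does not depend on which normalized eigenvector is
  chosen.\<close>
lemma normalized_eigenvector_weight:
  assumes ev: "eigenvector (jacobi_matrix a b (Suc m)) v t" and norm: "scalar_prod v v = 1"
  shows "b 0 * (vec_index v 0)\<^sup>2 = christoffel m t"
proof -
  define c where "c = vec_index v 0 * sqrt (b 0)"
  have v: "v \<in> carrier_vec (Suc m)"
    using ev by (auto simp: eigenvector_def jacobi_matrix_def)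
  have eq: "vec_index v i = c * orthonormal t i" if "i \<le> m" for i
    using eigenvector_jacobi_matrix(1)[OF ev that] by (simp add: c_def)
  have "1 = (\<Sum>i\<le>m. (c * orthonormal t i)\<^sup>2)"
    using norm v
    by (simp add: scalar_prod_def lessThan_atLeast0[symmetric] lessThan_Suc_atMost eq power2_eq_square)
  also have "\<dots> = c\<^sup>2 * (\<Sum>i\<le>m. (poly (rec_poly a b i) t)\<^sup>2 / sqnorm i)"
    by (simp add: sum_distrib_left orthonormal_square[symmetric] power_mult_distrib)
  finally have "c\<^sup>2 = christoffel m t"
    unfolding christoffel_def by (metis mult_zero_right nonzero_eq_divide_eq zero_neq_one)
  moreover have "c\<^sup>2 = b 0 * (vec_index v 0)\<^sup>2"
    using b_pos[of 0] by (simp add: c_def power_mult_distrib)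
  ultimately show ?thesis by simp
qed

end

section \<open>Discrete orthogonality and exactness of the quadrature rule\<close>

text \<open>A one-sided inverse of a square matrix is two-sided.\<close>
lemma orthonormal_rows_imp_columns:
  fixes u :: "nat \<Rightarrow> nat \<Rightarrow> 'a :: field"
  assumes rows: "\<And>k l. k < n \<Longrightarrow> l < n \<Longrightarrow> (\<Sum>i<n. u k i * u l i) = (if k = l then 1 else 0)"
    and ij: "i < n" "j < n"
  shows "(\<Sum>k<n. u k i * u k j) = (if i = j then 1 else 0)"
proof -
  define A where "A = Matrix.mat n n (\<lambda>(k, i). u k i)"
  have A: "A \<in> carrier_mat n n" by (simp add: A_def)
  have "A * transpose_mat A = 1\<^sub>m n"
    by (rule eq_matI) (auto simp: A_def scalar_prod_def rows lessThan_atLeast0[symmetric])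
  then have "transpose_mat A * A = 1\<^sub>m n"
    using mat_mult_left_right_inverse[OF A] A by simp
  then have "index_mat (transpose_mat A * A) (i, j) = (if i = j then 1 else 0)"
    using ij by simp
  then show ?thesis
    using ij by (simp add: A_def scalar_prod_def lessThan_atLeast0)
qed

context jacobi_recurrence begin

text \<open>The numbers \<open>\<surd>\<lambda>\<^sub>k r\<^sub>i(w\<^sub>k) / \<surd>h\<^sub>i\<close> form a square matrix with rows \<open>k\<close> and columns \<open>i\<close>. Its rows are
  orthonormal: distinct rows by the Christoffel--Darboux identity, whose right-hand side vanishes at two
  zeros of \<open>r\<^sub>n\<^sub>+\<^sub>1\<close>, and single rows by the choice of \<open>\<lambda>\<^sub>k\<close>. The claim is the orthonormality of the columns.\<close>
lemma discrete_orthogonality: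
  assumes inj: "inj_on w {1..Suc n}"
    and roots: "\<And>k. k \<in> {1..Suc n} \<Longrightarrow> poly (rec_poly a b (Suc n)) (w k) = 0"
    and ij: "i \<le> n" "j \<le> n"
  shows "(\<Sum>k=1..Suc n. christoffel n (w k) * (poly (rec_poly a b i) (w k) * poly (rec_poly a b j) (w k))) =
    (if i = j then sqnorm i else 0)"
proof -
  define u where "u k i = sqrt (christoffel n (w (Suc k))) * poly (rec_poly a b i) (w (Suc k)) / sqrt (sqnorm i)"
    for k i
  have sq: "sqrt (sqnorm i) * sqrt (sqnorm i) = sqnorm i" "sqrt (sqnorm i) \<noteq> 0" for i
    using sqnorm_pos[of i] by auto
  have nz: "sqnorm i \<noteq> 0" for i
    using sqnorm_pos[of i] by simp
  have rows: "(\<Sum>i<Suc n. u k i * u l i) = (if k = l then 1 else 0)" if "k < Suc n" "l < Suc n" for k l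
  proof -
    let ?x = "w (Suc k)" and ?y = "w (Suc l)"
    have "(\<Sum>i<Suc n. u k i * u l i) =
       sqrt (christoffel n ?x) * sqrt (christoffel n ?y) *
         (\<Sum>i\<le>n. poly (rec_poly a b i) ?x * poly (rec_poly a b i) ?y / sqnorm i)"
      unfolding u_def sum_distrib_left lessThan_Suc_atMost
      by (intro sum.cong refl) (simp add: sq abs_of_pos sqnorm_pos field_simps)
    also have "\<dots> = (if k = l then 1 else 0)"
    proof (cases "k = l")
      case True
      have "christoffel n ?x * (\<Sum>i\<le>n. (poly (rec_poly a b i) ?x)\<^sup>2 / sqnorm i) = 1"
        using christoffel_pos[of n ?x] unfolding christoffel_def by (auto simp: field_simps)
      then show ?thesis using True christoffel_pos[of n ?x] by (simp add: power2_eq_square)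
    next
      case False
      then have "?x \<noteq> ?y" using inj_onD[OF inj, of "Suc k" "Suc l"] that by auto
      moreover have "(?x - ?y) * (\<Sum>i\<le>n. poly (rec_poly a b i) ?x * poly (rec_poly a b i) ?y / sqnorm i) = 0"
        using christoffel_darboux[of ?x ?y n] roots that by simp
      ultimately show ?thesis using False by simp
    qed
    finally show ?thesis .
  qed
  have "(\<Sum>k=1..Suc n. christoffel n (w k) * (poly (rec_poly a b i) (w k) * poly (rec_poly a b j) (w k))) =
     sqrt (sqnorm i) * sqrt (sqnorm j) * (\<Sum>k<Suc n. u k i * u k j)"
    unfolding One_nat_def sum.atLeast1_atMost_eq sum_distrib_left u_def
    by (intro sum.cong refl) (use christoffel_pos in \<open>simp add: sq nz field_simps less_imp_le\<close>)
  also have "(\<Sum>k<Suc n. u k i * u k j) = (if i = j then 1 else 0)"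
    by (rule orthonormal_rows_imp_columns[OF rows]) (use ij in auto)
  finally show ?thesis by (simp add: sq abs_of_pos[OF sqnorm_pos])
qed

end

lemma monic_basis_expansion:
  fixes f :: "nat \<Rightarrow> 'a :: comm_ring_1 poly"
  assumes "\<And>j. j < n \<Longrightarrow> degree (f j) = j" "\<And>j. j < n \<Longrightarrow> coeff (f j) j = 1"
    and "\<And>i. i \<ge> n \<Longrightarrow> coeff p i = 0"
  shows "\<exists>c. p = (\<Sum>j<n. Polynomial.smult (c j) (f j))"
  using assms
proof (induction n arbitrary: p)
  case 0
  then show ?case by (simp add: poly_eq_iff)
next
  case (Suc n)
  define q where "q = p - Polynomial.smult (coeff p n) (f n)"
  have "coeff q i = 0" if "i \<ge> n" for i
  proof (cases "i = n")
    case True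
    then show ?thesis using Suc.prems(2)[of n] by (auto simp: q_def)
  next
    case False
    then show ?thesis using that Suc.prems(1)[of n] Suc.prems(3)[of i]
      by (auto simp: q_def coeff_eq_0)
  qed
  then obtain c where c: "q = (\<Sum>j<n. Polynomial.smult (c j) (f j))"
    using Suc.IH[of q] Suc.prems(1,2) by auto
  have "p = (\<Sum>j<Suc n. Polynomial.smult ((c(n := coeff p n)) j) (f j))"
    using c by (simp add: q_def diff_eq_eq)
  then show ?case by blast
qed

locale linear_functional =
  fixes L :: "real poly \<Rightarrow> real"
  assumes add: "L (p + q) = L p + L q"
    and smult: "L (Polynomial.smult c p) = c * L p"
begin

lemma zero [simp]: "L 0 = 0"
  using smult[of 0 0] by simp

lemma sum: "L (\<Sum>i\<in>A. f i) = (\<Sum>i\<in>A. L (f i))"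
  by (induction A rule: infinite_finite_induct) (simp_all add: add)

lemma diff: "L (p - q) = L p - L q"
  using add[of "p - q" q] by simp

end

text \<open>It suffices to compare two functionals on one monic polynomial of each degree.\<close>
lemma linear_functional_eqI:
  assumes "linear_functional L" "linear_functional Q"
    and f: "\<And>j. j < n \<Longrightarrow> degree (f j) = j" "\<And>j. j < n \<Longrightarrow> coeff (f j) j = 1"
    and eq: "\<And>j. j < n \<Longrightarrow> L (f j) = Q (f j)"
    and p: "degree p < n"
  shows "L p = Q p"
proof -
  interpret L: linear_functional L by fact
  interpret Q: linear_functional Q by fact
  obtain c where "p = (\<Sum>j<n. Polynomial.smult (c j) (f j))"
    using monic_basis_expansion[of n f p] f p by (auto simp: coeff_eq_0)
  then show ?thesis using eq by (simp add: L.sum L.smult Q.sum Q.smult)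
qed

context jacobi_recurrence begin

text \<open>The polynomials \<open>r\<^sub>0, \<dots>, r\<^sub>n\<^sub>-\<^sub>1, r\<^sub>n r\<^sub>0, \<dots>, r\<^sub>n r\<^sub>n\<^sub>-\<^sub>1\<close> are monic of degrees \<open>0, \<dots>, 2n - 1\<close>. The rule and
  the functional vanish on all of them except \<open>r\<^sub>0 = 1\<close>. Since \<open>r\<^sub>n\<^sup>2\<close>
  is not among them, \<open>b n\<close> may differ from the recurrence coefficient of the functional.\<close>
lemma quadrature_exactness:
  assumes inj: "inj_on w {1..Suc n}"
    and roots: "\<And>k. k \<in> {1..Suc n} \<Longrightarrow> poly (rec_poly a b (Suc n)) (w k) = 0"
    and L: "linear_functional L" "L 1 = b 0"
    and orth: "\<And>j. 0 < j \<Longrightarrow> j < n \<Longrightarrow> L (rec_poly a b j) = 0"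
      "\<And>j. j < n \<Longrightarrow> L (rec_poly a b n * rec_poly a b j) = 0"
    and p: "degree p < 2 * n"
  shows "(\<Sum>k=1..Suc n. christoffel n (w k) * poly p (w k)) = L p"
proof -
  define Q where "Q p = (\<Sum>k=1..Suc n. christoffel n (w k) * poly p (w k))" for p
  define f where "f j = (if j < n then rec_poly a b j else rec_poly a b n * rec_poly a b (j - n))" for j
  have Q: "linear_functional Q"
    by unfold_locales (simp_all add: Q_def sum.distrib sum_distrib_left algebra_simps del: sum.cl_ivl_Suc)
  have Qf: "Q (rec_poly a b i * rec_poly a b j) = (if i = j then sqnorm i else 0)" if "i \<le> n" "j \<le> n" for i j
    using discrete_orthogonality[OF inj roots that] by (simp add: Q_def del: sum.cl_ivl_Suc)
  have "L p = Q p"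
  proof (rule linear_functional_eqI[OF L(1) Q _ _ _ p])
    fix j assume j: "j < 2 * n"
    have "rec_poly a b i \<noteq> 0" for i using lead_coeff_rec_poly[of a b i] by force
    then have deg: "degree (rec_poly a b n * rec_poly a b (j - n)) = n + (j - n)"
      by (subst degree_mult_eq) auto
    then show "degree (f j) = j" by (simp add: f_def)
    have "lead_coeff (rec_poly a b n * rec_poly a b (j - n)) = 1"
      by (simp only: lead_coeff_mult degree_rec_poly lead_coeff_rec_poly)
    then show "coeff (f j) j = 1" using deg by (cases "j < n") (auto simp: f_def)
    consider "j = 0" | "0 < j" "j < n" | "n \<le> j" by linarith
    then show "L (f j) = Q (f j)"
    proof cases
      case 1
      then show ?thesis using j L(2) Qf[of 0 0] by (simp add: f_def sqnorm_0)
    next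
      case 2
      then show ?thesis using orth(1)[of j] Qf[of 0 j] by (simp add: f_def)
    next
      case 3
      then show ?thesis using orth(2)[of "j - n"] Qf[of n "j - n"] j by (simp add: f_def)
    qed
  qed
  then show ?thesis by (simp add: Q_def)
qed

end

section \<open>Monic orthogonal polynomials of a positive functional\<close>

text \<open>The integral enters the theory of orthogonal polynomials only through linearity and positivity on
  squares.\<close>
locale positive_functional = linear_functional +
  assumes pos: "p \<noteq> 0 \<Longrightarrow> L (p * p) > 0"
begin

definition monic_orthogonal :: "nat \<Rightarrow> real poly \<Rightarrow> bool" where
  "monic_orthogonal k p \<longleftrightarrow> degree p = k \<and> coeff p k = 1 \<and> (\<forall>j<k. L (monom 1 j * p) = 0)"

lemma monic_orthogonal_lower:
  assumes p: "monic_orthogonal k p" and q: "\<And>i. i \<ge> k \<Longrightarrow> coeff q i = 0"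
  shows "L (p * q) = 0"
proof -
  obtain c where "q = (\<Sum>j<k. Polynomial.smult (c j) (monom 1 j))"
    using monic_basis_expansion[of k "monom 1" q] q by (auto simp: degree_monom_eq)
  then show ?thesis using p
    by (simp add: sum_distrib_left sum smult monic_orthogonal_def mult.commute[of p])
qed

text \<open>One Gram--Schmidt step, applied to the next power.\<close>
lemma monic_orthogonal_exists: "\<exists>p. monic_orthogonal k p"
proof (induction k rule: less_induct)
  case (less k)
  then obtain f where f: "\<And>j. j < k \<Longrightarrow> monic_orthogonal j (f j)" by metis
  have f': "degree (f j) = j \<and> coeff (f j) j = 1" if "j < k" for j
    using f[OF that] by (auto simp: monic_orthogonal_def)
  have h: "L (f j * f j) > 0" if "j < k" for j
    using f'[OF that] by (intro pos) force
  have ortho: "L (f i * f j) = 0" if "i < k" "j < k" "i \<noteq> j" for i j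
  proof -
    have *: "L (f i * f j) = 0" if "j < i" "i < k" for i j
      using that f' by (intro monic_orthogonal_lower[OF f]) (auto intro!: coeff_eq_0)
    show ?thesis using *[of j i] *[of i j] that by (cases "j < i") (auto simp: mult.commute)
  qed
  define s where "s = (\<Sum>j<k. Polynomial.smult (L (monom 1 k * f j) / L (f j * f j)) (f j))"
  define p where "p = monom 1 k - s"
  have s: "coeff s i = 0" if "i \<ge> k" for i
    unfolding s_def coeff_sum using that f' by (intro sum.neutral) (auto simp: coeff_eq_0)
  have pk: "coeff p k = 1" "\<And>i. i > k \<Longrightarrow> coeff p i = 0" using s by (auto simp: p_def)
  have deg: "degree p = k"
    by (metis le_degree degree_le pk le_antisym zero_neq_one)
  have pf: "L (p * f j) = 0" if j: "j < k" for j
  proof -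
    have "L (s * f j) = (\<Sum>i<k. if i = j then L (monom 1 k * f j) else 0)"
      unfolding s_def sum_distrib_right sum using j h[OF j]
      by (intro sum.cong refl) (auto simp: smult ortho)
    then show ?thesis using j by (simp add: p_def left_diff_distrib diff)
  qed
  have "L (monom 1 j * p) = 0" if j: "j < k" for j
  proof -
    obtain c where "monom 1 j = (\<Sum>j<k. Polynomial.smult (c j) (f j))"
      using monic_basis_expansion[of k f "monom 1 j"] f' j by auto
    then show ?thesis using pf by (simp add: sum_distrib_left sum smult mult.commute[of _ p])
  qed
  then show ?case using pk deg by (auto simp: monic_orthogonal_def)
qed

lemma monic_orthogonal_unique:
  assumes "monic_orthogonal k p" "monic_orthogonal k q"
  shows "p = q"
proof (rule ccontr)
  assume "p \<noteq> q"
  then have "L ((p - q) * (p - q)) > 0" by (intro pos) simp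
  moreover have low: "coeff (p - q) i = 0" if "i \<ge> k" for i
    using assms that by (cases "i = k") (auto simp: monic_orthogonal_def coeff_eq_0)
  have "L (p * (p - q)) = 0" "L (q * (p - q)) = 0"
    using assms low by (auto intro: monic_orthogonal_lower)
  then have "L ((p - q) * (p - q)) = 0"
    by (simp add: left_diff_distrib diff)
  ultimately show False by simp
qed

definition ortho :: "nat \<Rightarrow> real poly" where
  "ortho k = (THE p. monic_orthogonal k p)"

lemma monic_orthogonal_ortho: "monic_orthogonal k (ortho k)"
  unfolding ortho_def using monic_orthogonal_exists monic_orthogonal_unique by (metis theI)

lemma ortho_monic: "degree (ortho k) = k" "coeff (ortho k) k = 1"
  using monic_orthogonal_ortho[of k] by (auto simp: monic_orthogonal_def)

lemma ortho_orthogonal: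
  assumes "degree q < k" shows "L (ortho k * q) = 0"
  using monic_orthogonal_lower[OF monic_orthogonal_ortho] assms by (auto simp: coeff_eq_0)

lemma ortho_0: "ortho 0 = 1"
  using ortho_monic[of 0] by (metis degree_0_id pCons_0_0 degree_eq_zeroE coeff_pCons_0 one_pCons)

definition ortho_sqnorm :: "nat \<Rightarrow> real" where "ortho_sqnorm k = L (ortho k * ortho k)"

lemma ortho_sqnorm_pos: "ortho_sqnorm k > 0"
  unfolding ortho_sqnorm_def by (rule pos) (use ortho_monic[of k] in force)

lemma leading_moment:
  assumes "degree q \<le> k"
  shows "L (ortho k * q) = coeff q k * ortho_sqnorm k"
proof -
  have "L (ortho k * (q - Polynomial.smult (coeff q k) (ortho k))) = 0"
  proof (rule monic_orthogonal_lower[OF monic_orthogonal_ortho])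
    fix i assume "i \<ge> k"
    then show "coeff (q - Polynomial.smult (coeff q k) (ortho k)) i = 0"
      using ortho_monic[of k] assms by (cases "i = k") (auto simp: coeff_eq_0)
  qed
  then show ?thesis by (simp add: right_diff_distrib diff smult ortho_sqnorm_def)
qed

definition alpha :: "nat \<Rightarrow> real" where
  "alpha k = L ([:0, 1:] * ortho k * ortho k) / ortho_sqnorm k"

definition beta :: "nat \<Rightarrow> real" where
  "beta k = (if k = 0 then ortho_sqnorm 0 else ortho_sqnorm k / ortho_sqnorm (k - 1))"

text \<open>The difference \<open>d\<close> of the two sides has degree at most \<open>k\<close> and is orthogonal to \<open>p\<^sub>0, \<dots>, p\<^sub>k\<close>. So it is
  orthogonal to itself, and positivity gives \<open>d = 0\<close>.\<close>
lemma ortho_recurrence: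
  "ortho (Suc k) = [:- alpha k, 1:] * ortho k -
     (if k = 0 then 0 else Polynomial.smult (beta k) (ortho (k - 1)))"
proof -
  define r where "r = [:- alpha k, 1:] * ortho k -
     (if k = 0 then 0 else Polynomial.smult (beta k) (ortho (k - 1)))"
  define d where "d = ortho (Suc k) - r"
  have low: "coeff d i = 0" if "i \<ge> Suc k" for i
    using that ortho_monic[of k] ortho_monic[of "Suc k"] ortho_monic[of "k - 1"]
    by (cases "i = Suc k") (auto simp: d_def r_def coeff_eq_0 coeff_pCons split: nat.split)
  have dj: "L (d * ortho j) = 0" if j: "j \<le> k" for j
  proof -
    have x: "L ([:- alpha k, 1:] * ortho k * ortho j) = L (ortho k * pCons 0 (ortho j)) - alpha k * L (ortho k * ortho j)"
    proof -
      have "[:- alpha k, 1:] * ortho k * ortho j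
        = ortho k * pCons 0 (ortho j) - Polynomial.smult (alpha k) (ortho k * ortho j)"
        by (simp add: algebra_simps)
      then show ?thesis by (simp add: diff smult)
    qed
    have o: "L (ortho (Suc k) * ortho j) = 0"
      using j by (intro ortho_orthogonal) (simp add: ortho_monic)
    have y: "L ((if k = 0 then 0 else Polynomial.smult (beta k) (ortho (k - 1))) * ortho j)
       = (if k = 0 then 0 else beta k * L (ortho (k - 1) * ortho j))"
      by (simp add: smult)
    have split: "L (d * ortho j) = - (L (ortho k * pCons 0 (ortho j)) - alpha k * L (ortho k * ortho j)
       - (if k = 0 then 0 else beta k * L (ortho (k - 1) * ortho j)))"
      unfolding d_def r_def left_diff_distrib diff o x y by simp
    have dp: "degree (pCons 0 (ortho j)) = Suc j"
      using ortho_monic[of j] by (subst degree_pCons_eq) auto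
    consider "j = k" | "Suc j = k" | "Suc j < k" using j by linarith
    then show ?thesis
    proof cases
      case 1
      have "k > 0 \<Longrightarrow> L (ortho (k - 1) * ortho k) = 0"
        using ortho_orthogonal[of "ortho (k - 1)" k] by (simp add: ortho_monic mult.commute)
      moreover have "L (ortho k * pCons 0 (ortho k)) = alpha k * ortho_sqnorm k"
        using ortho_sqnorm_pos[of k] by (simp add: alpha_def)
      ultimately show ?thesis unfolding split using 1 by (simp add: ortho_sqnorm_def)
    next
      case 2
      have "L (ortho k * pCons 0 (ortho j)) = ortho_sqnorm k"
        using leading_moment[of "pCons 0 (ortho j)" k] 2 dp ortho_monic[of j] by auto
      moreover have "L (ortho k * ortho j) = 0"
        using 2 by (intro ortho_orthogonal) (simp add: ortho_monic)
      ultimately show ?thesis unfolding split using 2 ortho_sqnorm_pos[of j] by (auto simp: beta_def ortho_sqnorm_def)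
    next
      case 3
      have "L (ortho k * pCons 0 (ortho j)) = 0" "L (ortho k * ortho j) = 0"
         "L (ortho (k - 1) * ortho j) = 0"
        using 3 dp by (intro ortho_orthogonal; simp add: ortho_monic)+
      then show ?thesis unfolding split by simp
    qed
  qed
  obtain c where c: "d = (\<Sum>j<Suc k. Polynomial.smult (c j) (ortho j))"
    using monic_basis_expansion[of "Suc k" ortho d] low ortho_monic by auto
  have "L (d * d) = (\<Sum>j<Suc k. c j * L (d * ortho j))"
    by (subst (2) c) (simp add: sum_distrib_left sum smult distrib_left add)
  also have "\<dots> = 0" using dj by (intro sum.neutral) auto
  finally have "d = 0" using pos[of d] by force
  then show ?thesis by (simp add: d_def r_def)
qed

lemma ortho_eq_rec_poly: "ortho n = rec_poly alpha beta n"
proof (induction n rule: less_induct)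
  case (less n)
  consider "n = 0" | "n = Suc 0" | k where "n = Suc (Suc k)" by (metis not0_implies_Suc)
  then show ?case
  proof cases
    case 1
    then show ?thesis by (simp add: ortho_0)
  next
    case 2
    then show ?thesis using ortho_recurrence[of 0] by (simp add: ortho_0)
  next
    case 3
    then show ?thesis using ortho_recurrence[of "Suc k"] less.IH[of k] less.IH[of "Suc k"] by simp
  qed
qed

lemma beta_pos: "beta k > 0"
  using ortho_sqnorm_pos by (simp add: beta_def)

text \<open>The quotients telescope, which identifies the squared norms with the ones of the abstract recurrence.\<close>
lemma prod_beta: "(\<Prod>i\<le>n. beta i) = ortho_sqnorm n"
  using ortho_sqnorm_pos by (induction n) (auto simp: beta_def less_imp_neq[symmetric])

end

section \<open>The functional of an admissible measure\<close>

lemma integrable_poly: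
  fixes p :: "real poly"
  assumes "\<And>k. set_integrable M D (\<lambda>x::real. x ^ k)"
  shows "set_integrable M D (poly p)"
proof -
  have "set_integrable M D (\<lambda>x. \<Sum>i\<le>degree p. coeff p i * x ^ i)"
    using assms unfolding set_integrable_def real_scaleR_def sum_distrib_left
    by (intro Bochner_Integration.integrable_sum) (subst mult.left_commute, simp)
  then show ?thesis by (simp add: poly_altdef[abs_def])
qed

text \<open>If the integral were zero, \<open>p\<close> would vanish almost everywhere. The set where \<open>p \<noteq> 0\<close> is open, so its
  points would lie outside the support, and the infinite support would be contained in the finite set
  of zeros of \<open>p\<close>.\<close>
lemma admissible_integral_square_pos:
  fixes p :: "real poly"
  assumes adm: "admissible_measure D M" and p: "p \<noteq> 0"
  shows "(LINT x:D|M. (poly p x)\<^sup>2) > 0"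
proof -
  have sets: "sets M = sets borel" and null: "emeasure M (- D) = 0"
    and inf: "infinite (support_points M)"
    and mom: "\<And>k. set_integrable M D (\<lambda>x::real. x ^ k)"
    using adm by (auto simp: admissible_measure_def)
  \<comment> \<open>the zeroth moment already makes \<open>D\<close> measurable\<close>
  have "(indicator D :: real \<Rightarrow> real) \<in> borel_measurable M"
    using borel_measurable_integrable[OF mom[of 0, unfolded set_integrable_def]] by simp
  then have D: "D \<in> sets M"
    using sets_eq_imp_space_eq[OF sets] by (simp add: borel_measurable_indicator_iff)
  have i: "set_integrable M D (\<lambda>x. (poly p x)\<^sup>2)"
    using integrable_poly[OF mom, of "p * p"] by (simp add: power2_eq_square fun_eq_iff cong: set_integrable_cong)
  have nn: "(LINT x:D|M. (poly p x)\<^sup>2) \<ge> 0"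
    unfolding set_lebesgue_integral_def by (rule integral_nonneg_AE) auto
  moreover have "(LINT x:D|M. (poly p x)\<^sup>2) \<noteq> 0"
  proof
    assume z: "(LINT x:D|M. (poly p x)\<^sup>2) = 0"
    have "AE x in M. indicator D x *\<^sub>R (poly p x)\<^sup>2 = 0"
      using i z unfolding set_lebesgue_integral_def set_integrable_def
      by (subst (asm) integral_nonneg_eq_0_iff_AE) auto
    moreover have "AE x in M. x \<in> D"
      by (rule AE_I'[of "- D"]) (use D null sets in \<open>auto simp: null_sets_def\<close>)
    ultimately have "AE x in M. poly p x = 0" by eventually_elim auto
    moreover have meas: "{x. poly p x \<noteq> 0} \<in> sets M"
    proof -
      have "open {x. poly p x \<noteq> 0}" by (intro open_Collect_neq continuous_intros)
      then show ?thesis using sets by simp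
    qed
    ultimately have nul: "emeasure M {x. poly p x \<noteq> 0} = 0"
      using sets_eq_imp_space_eq[OF sets] by (subst (asm) AE_iff_measurable[OF meas]) auto
    have "support_points M \<subseteq> {x. poly p x = 0}"
    proof
      fix x assume x: "x \<in> support_points M"
      show "x \<in> {x. poly p x = 0}"
      proof (rule ccontr)
        assume "x \<notin> {x. poly p x = 0}"
        moreover have "open {x. poly p x \<noteq> 0}" by (intro open_Collect_neq continuous_intros)
        ultimately obtain e where "e > 0" "ball x e \<subseteq> {x. poly p x \<noteq> 0}"
          by (auto simp: open_contains_ball)
        then have "emeasure M (ball x e) \<le> 0" "emeasure M (ball x e) > 0"
          using emeasure_mono[OF _ meas] nul x by (auto simp: support_points_def)
        then show False by simp
      qed
    qed
    then show False using inf poly_roots_finite[OF p] finite_subset by blast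
  qed
  ultimately show ?thesis by linarith
qed

lemma positive_functional_admissible:
  assumes "admissible_measure D M"
  shows "positive_functional (\<lambda>p. LINT x:D|M. poly p x)"
proof
  have i: "set_integrable M D (poly p)" for p
    by (rule integrable_poly) (use assms in \<open>simp add: admissible_measure_def\<close>)
  fix p q :: "real poly" and c :: real
  show "(LINT x:D|M. poly (p + q) x) = (LINT x:D|M. poly p x) + (LINT x:D|M. poly q x)"
    using set_integral_add(2)[OF i[of p] i[of q]] by simp
  show "(LINT x:D|M. poly (Polynomial.smult c p) x) = c * (LINT x:D|M. poly p x)"
    by simp
  show "(LINT x:D|M. poly (p * p) x) > 0" if "p \<noteq> 0"
    using admissible_integral_square_pos[OF assms that] by (simp add: power2_eq_square)
qed

section \<open>The bordered Jacobi matrix and its quadrature rule\<close>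

lemma jacobi_star_mat_eq:
  assumes "m \<ge> 1"
  shows "jacobi_star_mat D M m = jacobi_matrix (rec_alpha D M)
    ((rec_beta D M)(m := rec_beta D M m + rec_beta D M (m + 1))) (Suc m)"
  using assms
  by (intro eq_matI)
    (auto simp: jacobi_star_mat_def jacobi_mat_def jacobi_matrix_def Let_def mat_of_cols_def
      mat_of_rows_def less_Suc_eq unit_vec_def)

lemma sorted_list_of_set_strict_mono_image:
  fixes w :: "nat \<Rightarrow> 'a :: linorder"
  assumes w: "strict_mono_on {1..n} w" and k: "k \<in> {1..n}"
  shows "sorted_list_of_set (w ` {1..n}) ! (k - 1) = w k"
proof -
  have "sorted_wrt (<) (map w [1..<Suc n])"
    unfolding sorted_wrt_map
    by (rule sorted_wrt_mono_rel[OF _ sorted_wrt_upt]) (auto intro: strict_mono_onD[OF w])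
  then have "sorted_list_of_set (w ` {1..n}) = map w [1..<Suc n]"
    by (intro sorted_distinct_set_unique)
       (auto simp: strict_sorted_iff atLeastLessThanSuc_atLeastAtMost simp del: upt_Suc)
  then show ?thesis using k by (cases k) (auto simp del: upt_Suc)
qed

theorem theorem2p1:
  fixes D :: "real set" and M :: "real measure" and m :: nat
  assumes "admissible_measure D M" and "m \<ge> 1"
  shows
    "(strict_mono_on {1..m+1} (star_node D M m) \<and>
      star_node D M m ` {1..m+1} = {t. eigenvalue (jacobi_star_mat D M m) t}) \<and>
     (\<forall>p :: real poly. degree p \<le> 2 * m - 1 \<longrightarrow>
        star_rule D M m (poly p) = (LINT x:D|M. poly p x)) \<and>
     (\<exists>z :: nat \<Rightarrow> real. strict_mono_on {1..m} z \<and>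
        z ` {1..m} = {t. poly (orthopoly D M m) t = 0} \<and>
        (\<forall>k\<in>{1..m}. star_node D M m k < z k \<and> z k < star_node D M m (k + 1))) \<and>
     (\<forall>k\<in>{1..m+1}.
        star_weight D M m k =
          (rec_beta D M m + rec_beta D M (m + 1)) / rec_beta D M m *
          ((norm_mu D M (poly (orthopoly D M m)))\<^sup>2 /
             poly (pderiv (q_poly D M m)) (star_node D M m k)) \<and>
        star_weight D M m k > 0)"
proof -
  define L where "L p = (LINT x:D|M. poly p x)" for p
  interpret positive_functional L
    unfolding L_def by (rule positive_functional_admissible[OF assms(1)])
  define a where "a = rec_alpha D M"
  define b where "b = (rec_beta D M)(m := rec_beta D M m + rec_beta D M (m + 1))"
  have inner: "inner_mu D M (poly p) (poly q) = L (p * q)" for p q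
    by (simp add: inner_mu_def L_def)
  have ortho: "orthopoly D M = ortho"
  proof
    fix k
    have "inner_mu D M (\<lambda>x. x ^ j) (poly p) = L (monom 1 j * p)" for j p
      by (simp add: inner_mu_def L_def poly_monom)
    then show "orthopoly D M k = ortho k"
      unfolding orthopoly_def ortho_def monic_orthogonal_def by metis
  qed
  have alpha: "rec_alpha D M = alpha"
  proof
    fix k
    show "rec_alpha D M k = alpha k"
      by (simp add: rec_alpha_def alpha_def ortho ortho_sqnorm_def inner) (simp add: inner_mu_def L_def mult.assoc)
  qed
  have beta: "rec_beta D M = beta"
    by (auto simp: rec_beta_def beta_def ortho ortho_sqnorm_def inner fun_eq_iff)
  interpret J: jacobi_recurrence a b
    by unfold_locales (auto simp: b_def beta beta_pos add_pos_pos)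
  \<comment> \<open>the changed coefficient \<open>b m\<close> first enters in degree \<open>m + 1\<close>\<close>
  have r: "rec_poly a b n = ortho n" if "n \<le> m" for n
    unfolding ortho_eq_rec_poly a_def alpha
    by (rule rec_poly_cong) (use that in \<open>auto simp: b_def beta\<close>)
  have Jmat: "jacobi_star_mat D M m = jacobi_matrix a b (Suc m)"
    using jacobi_star_mat_eq[OF assms(2)] by (simp add: a_def b_def)
  obtain z w where z: "strict_mono_on {1..m} z" "rec_poly a b m = (\<Prod>k=1..m. [:- z k, 1:])"
    and w: "strict_mono_on {1..Suc m} w" "rec_poly a b (Suc m) = (\<Prod>k=1..Suc m. [:- w k, 1:])"
    and zw: "\<And>k. k \<in> {1..m} \<Longrightarrow> w k < z k \<and> z k < w (Suc k)"
    using J.interlacing_roots[of m] by metis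
  have "poly (rec_poly a b (Suc m)) t = 0 \<longleftrightarrow> t \<in> w ` {1..Suc m}" for t
    unfolding w(2) poly_prod by (auto simp: prod_zero_iff simp del: prod.cl_ivl_Suc)
  then have eig: "{t. eigenvalue (jacobi_star_mat D M m) t} = w ` {1..Suc m}"
    unfolding Jmat J.eigenvalue_jacobi_matrix_iff by auto
  have node: "star_node D M m k = w k" if "k \<in> {1..Suc m}" for k
    unfolding star_node_def eig by (rule sorted_list_of_set_strict_mono_image[OF w(1) that])
  have wroot: "poly (rec_poly a b (Suc m)) (w k) = 0" if "k \<in> {1..Suc m}" for k
    unfolding w(2) poly_prod by (rule prod_zero) (use that in auto)
  have weight: "star_weight D M m k = J.christoffel m (w k)" if k: "k \<in> {1..Suc m}" for k
  proof -
    let ?v = "SOME v. eigenvector (jacobi_star_mat D M m) v (star_node D M m k) \<and> scalar_prod v v = 1"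
    have "eigenvector (jacobi_matrix a b (Suc m)) ?v (w k) \<and> scalar_prod ?v ?v = 1"
      unfolding Jmat node[OF k]
      by (rule someI_ex[OF J.normalized_eigenvector_exists[OF wroot[OF k]]])
    then have "b 0 * (vec_index ?v 0)\<^sup>2 = J.christoffel m (w k)"
      by (intro J.normalized_eigenvector_weight) auto
    \<comment> \<open>here \<open>m \<ge> 1\<close> ensures that \<open>b 0\<close> is the unmodified \<open>\<beta>\<^sub>0\<close>\<close>
    then show ?thesis using assms(2) by (simp add: star_weight_def Let_def b_def)
  qed
  have inj: "inj_on w {1..Suc m}" by (rule strict_mono_on_imp_inj_on[OF w(1)])

  have nodes: "strict_mono_on {1..m+1} (star_node D M m) \<and>
      star_node D M m ` {1..m+1} = {t. eigenvalue (jacobi_star_mat D M m) t}"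
    using w(1) node by (auto simp: eig strict_mono_on_def image_iff)

  have exact: "star_rule D M m (poly p) = (LINT x:D|M. poly p x)" if p: "degree p \<le> 2 * m - 1" for p
  proof -
    have "star_rule D M m (poly p) = (\<Sum>k=1..Suc m. J.christoffel m (w k) * poly p (w k))"
      unfolding star_rule_def Suc_eq_plus1[symmetric]
      by (intro sum.cong refl) (simp only: node weight)
    also have "\<dots> = L p"
    proof (rule J.quadrature_exactness[OF inj wroot])
      show "linear_functional L" by unfold_locales
      show "L 1 = b 0" using assms(2) by (simp add: b_def beta beta_def ortho_sqnorm_def ortho_0)
      show "L (rec_poly a b j) = 0" if "0 < j" "j < m" for j
        using ortho_orthogonal[of 1 j] that by (simp add: r)
      show "L (rec_poly a b m * rec_poly a b j) = 0" if "j < m" for j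
        using ortho_orthogonal[of "ortho j" m] that by (simp add: r ortho_monic)
      show "degree p < 2 * m" using p assms(2) by linarith
    qed
    finally show ?thesis by (simp add: L_def)
  qed

  have interlace: "strict_mono_on {1..m} z \<and> z ` {1..m} = {t. poly (orthopoly D M m) t = 0} \<and>
        (\<forall>k\<in>{1..m}. star_node D M m k < z k \<and> z k < star_node D M m (k + 1))"
  proof (intro conjI ballI)
    show "z ` {1..m} = {t. poly (orthopoly D M m) t = 0}"
      unfolding ortho r[OF order_refl, symmetric] z(2) poly_prod by (auto simp: prod_zero_iff)
  qed (use z(1) zw node in auto)

  have starp: "star_poly D M m = rec_poly a b (Suc m)"
    unfolding w(2) star_poly_def Suc_eq_plus1[symmetric] by (intro prod.cong refl) (simp only: node)
  have "star_weight D M m k =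
          (rec_beta D M m + rec_beta D M (m + 1)) / rec_beta D M m *
          ((norm_mu D M (poly (orthopoly D M m)))\<^sup>2 /
             poly (pderiv (q_poly D M m)) (star_node D M m k)) \<and>
        star_weight D M m k > 0" if k: "k \<in> {1..m+1}" for k
  proof -
    have k': "k \<in> {1..Suc m}" using k by simp
    have q: "poly (pderiv (q_poly D M m)) (w k) = poly (rec_poly a b m) (w k) * poly (pderiv (rec_poly a b (Suc m))) (w k)"
      unfolding q_poly_def starp ortho r[OF order_refl, symmetric]
      using wroot[OF k'] by (simp add: pderiv_mult del: rec_poly.simps)
    have nrm: "(norm_mu D M (poly (orthopoly D M m)))\<^sup>2 = ortho_sqnorm m"
      using ortho_sqnorm_pos[of m] by (simp add: norm_mu_def ortho inner ortho_sqnorm_def)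
    obtain l where l: "m = Suc l" using assms(2) by (cases m) auto
    \<comment> \<open>up to index \<open>l = m - 1\<close> both sequences have the same squared norms; one step separates them\<close>
    have "J.sqnorm l = ortho_sqnorm l"
      unfolding J.sqnorm_def prod_beta[symmetric] by (rule prod.cong) (auto simp: b_def beta l)
    then have "J.sqnorm m = (beta m + beta (m + 1)) * ortho_sqnorm l"
      using J.sqnorm_Suc[of l] by (simp add: l b_def beta)
    moreover have "ortho_sqnorm m = beta m * ortho_sqnorm l" using ortho_sqnorm_pos[of l] by (simp add: beta_def l)
    ultimately have "J.sqnorm m = (beta m + beta (m + 1)) / beta m * ortho_sqnorm m"
      using beta_pos[of m] by simp
    then show ?thesis
      using J.christoffel_eq[OF wroot[OF k']] J.christoffel_pos[of m "w k"]
      by (simp add: weight[OF k'] node[OF k'] q nrm beta)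
  qed
  then show ?thesis using nodes exact interlace by blast
qed

end
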